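(* Let $D$ be a bipartite digraph with outradius $r \ge 3$ and order $n$. Then $$\lvert A(D)\rvert \le \left\lceil \frac{n(n-2)}{4}\right\rceil + r - 4 + \left\lfloor \frac{(n-r+3)^2}{4}\right\rfloor.$$ Equality occurs if and only if $D$ is isomorphic to a digraph obtained from $H_r$ by taking blow-ups of three consecutive non-end vertices $v_j, v_{j+1}, v_{j+2}$ (with $1\le j$ and $j+2\le r-1$) by stable sets of sizes $a, b, c$ respectively (positive integers with $a+b+c=n-r+2$) satisfying $\lvert a+c-(b+1)\rvert \le 1$, with the additional constraint, when $r$ is odd, that the bipartition class containing $v_0$ (the vertex of out-eccentricity $r$) is at least as large as the other bipartition class.
   Context: Digraphs are finite, without loops or multiple arcs; a digraph is bipartite if its vertex set splits into two independent sets (no arcs inside a class). $d(u,v)$ is the length of a shortest directed path ($+\infty$ if none); out-eccentricity $\mathrm{ecc}^+(v)=\max_u d(v,u)$; outradius $=\min_v \mathrm{ecc}^+(v)$. $\overline{\Gamma}^\star_{r+1}$ is the digraph on $\{v_0,v_1,\dots,v_r\}$ with arcs $\vec{v_iv_j}$ for all $1\le i,j\le r$ with $i\ne j$ and $i\ge j-1$, plus the single arc $\vec{v_0v_1}$. $H_r$ is the bipartite subdigraph of $\overline{\Gamma}^\star_{r+1}$ obtained by keeping only arcs between vertices of different index parity, with bipartition $\{v_i: i \text{ even}\}\cup\{v_i: i\text{ odd}\}$. Blowing up a vertex $x$ by a stable set of size $m$ means replacing $x$ by $m$ pairwise non-adjacent vertices each inheriting all arcs (with directions) of $x$; when adjacent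 vertices are both blown up, all arcs between their copies in the original directions are present.
   Formalization: For r = 3 no triple v_j, v_{j+1}, v_{j+2} of non-end vertices exists, yet H_3 attains the bound (n = 4, 5 arcs); the equality case for r = 3 is therefore taken as blow-ups of v_1, v_2 with v_3 kept single (j = 1, c = 1). *)

theory Defs
  imports "Graph_Theory.Graph_Theory"
begin

text \<open>
  Digraphs without loops and multiple arcs are the \<^locale>\<open>digraph\<close> locale. The distance
  is the library's \<open>\<mu>\<close> with all arc weights \<open>1\<close>, valued in the extended reals
  (\<open>\<infinity>\<close> if there is no walk). On a finite nonempty vertex set, the supremum and the infimum
  below are the maximum and the minimum.
\<close>

definition (in wf_digraph) out_ecc :: "'a \<Rightarrow> ereal" where
  "out_ecc v = (SUP u\<in>verts G. \<mu> (\<lambda>_. 1) v u)"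

definition (in wf_digraph) out_radius :: ereal where
  "out_radius = (INF v\<in>verts G. out_ecc v)"

definition independent_set :: "('a, 'b) pre_digraph \<Rightarrow> 'a set \<Rightarrow> bool" where
  "independent_set G S \<longleftrightarrow>
     S \<subseteq> verts G \<and> (\<forall>e\<in>arcs G. \<not> (tail G e \<in> S \<and> head G e \<in> S))"

definition bipartite_digraph :: "('a, 'b) pre_digraph \<Rightarrow> bool" where
  "bipartite_digraph G \<longleftrightarrow>
     (\<exists>U V. U \<union> V = verts G \<and> U \<inter> V = {} \<and> independent_set G U \<and> independent_set G V)"

text \<open>
  The digraph with vertices \<open>v\<^sub>0, \<dots>, v\<^sub>r\<close> (so of order \<open>r + 1\<close>); the vertex \<open>v\<^sub>i\<close> is the
  number \<open>i\<close>. The condition \<open>i \<ge> j - 1\<close> is stated without truncated subtraction.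
\<close>

definition Gamma_star :: "nat \<Rightarrow> (nat, nat \<times> nat) pre_digraph" where
  "Gamma_star r =
     \<lparr>verts = {0..r},
      arcs = {(i, j). i \<in> {1..r} \<and> j \<in> {1..r} \<and> i \<noteq> j \<and> i + 1 \<ge> j} \<union> {(0, 1)},
      tail = fst, head = snd\<rparr>"

definition H_digraph :: "nat \<Rightarrow> (nat, nat \<times> nat) pre_digraph" where
  "H_digraph r =
     (Gamma_star r)\<lparr>arcs := {(i, j) \<in> arcs (Gamma_star r). even i \<noteq> even j}\<rparr>"

text \<open>
  Every vertex \<open>x\<close> is blown up by a stable set of size \<open>m x\<close>, the copies of \<open>x\<close> being
  \<open>(x, k)\<close> with \<open>k < m x\<close>; vertices with \<open>m x = 1\<close> are left as they are.
\<close>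

definition blow_up ::
  "('a, 'b) pre_digraph \<Rightarrow> ('a \<Rightarrow> nat) \<Rightarrow> ('a \<times> nat, 'b \<times> nat \<times> nat) pre_digraph" where
  "blow_up G m =
     \<lparr>verts = {(x, k). x \<in> verts G \<and> k < m x},
      arcs = {(e, k, l). e \<in> arcs G \<and> k < m (tail G e) \<and> l < m (head G e)},
      tail = (\<lambda>(e, k, l). (tail G e, k)),
      head = (\<lambda>(e, k, l). (head G e, l))\<rparr>"

text \<open>
  The blow-up of \<open>H\<^sub>r\<close> in \<open>v\<^sub>j\<close>, \<open>v\<^bsub>j+1\<^esub>\<close>, \<open>v\<^bsub>j+2\<^esub>\<close>, and its two bipartition classes, inherited
  from the index parity in \<open>H\<^sub>r\<close>; \<open>v\<^sub>0\<close> lies in the even one.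
\<close>

definition H_blow_up ::
  "nat \<Rightarrow> nat \<Rightarrow> nat \<Rightarrow> nat \<Rightarrow> nat \<Rightarrow> (nat \<times> nat, (nat \<times> nat) \<times> nat \<times> nat) pre_digraph" where
  "H_blow_up r j a b c = blow_up (H_digraph r) ((\<lambda>_. 1)(j := a, j + 1 := b, j + 2 := c))"

definition even_class :: "(nat \<times> nat, 'b) pre_digraph \<Rightarrow> (nat \<times> nat) set" where
  "even_class B = {v \<in> verts B. even (fst v)}"

definition odd_class :: "(nat \<times> nat, 'b) pre_digraph \<Rightarrow> (nat \<times> nat) set" where
  "odd_class B = {v \<in> verts B. odd (fst v)}"

text \<open>
  Which vertices may be blown up: \<open>v\<^sub>j\<close>, \<open>v\<^bsub>j+1\<^esub>\<close>, \<open>v\<^bsub>j+2\<^esub>\<close> are non-end vertices of \<open>H\<^sub>r\<close>. For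
  \<open>r = 3\<close> there are only two non-end vertices, \<open>v\<^sub>1\<close> and \<open>v\<^sub>2\<close>, so no admissible triple; the
  second disjunct is the degenerate case in which these two are blown up (sizes \<open>a\<close>, \<open>b\<close>) and
  \<open>v\<^sub>3\<close> is kept single. Without it the characterization of equality would fail for \<open>r = 3\<close>:
  \<open>H\<^sub>3\<close> itself has outradius 3, order 4 and 5 arcs, which is the bound. For \<open>r \<ge> 4\<close> the
  disjunct is void.
\<close>

definition blow_up_position :: "nat \<Rightarrow> nat \<Rightarrow> nat \<Rightarrow> bool" where
  "blow_up_position r j c \<longleftrightarrow> (1 \<le> j \<and> j + 2 \<le> r - 1) \<or> (r = 3 \<and> j = 1 \<and> c = 1)"

end

theory Submission
  imports Defs
begin

text \<open>
  Take the distance layers \<open>L\<^sub>0 = {v\<^sub>0}, L\<^sub>1, \<dots>, L\<^sub>r\<close> from a vertex \<open>v\<^sub>0\<close> of out-eccentricity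
  \<open>r\<close>. Layers of equal parity form the bipartition classes, of sizes \<open>P\<close> (even) and \<open>Q\<close>, and an
  arc climbs at most one layer. If \<open>v\<^sub>0\<close> is a source, this leaves room for
  \<open>(P - 1) Q\<close> arcs directed downwards and \<open>\<Sum> \<bar>L\<^sub>i\<bar> \<bar>L\<^bsub>i+1\<^esub>\<bar>\<close> arcs directed upwards. If it is not,
  then every other vertex misses one of the arcs permitted by the layers, since otherwise its
  out-eccentricity would be less than \<open>r\<close>; these \<open>n - 1\<close> missing arcs outnumber the at most \<open>Q\<close>
  additional arcs into \<open>v\<^sub>0\<close>. Both terms are then maximized over the layer sizes: with
  \<open>\<bar>L\<^sub>i\<bar> = 1 + x\<^sub>i\<close> the second one is \<open>r + 2 \<Sum> x\<^sub>i - x\<^sub>r + \<Sum> x\<^sub>i x\<^bsub>i+1\<^esub>\<close>, and the products of consecutive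
  \<open>x\<^sub>i\<close> add up to at most the product of the even-indexed and the odd-indexed sum, with equality
  only if the support of \<open>x\<close> lies in few consecutive indices.
\<close>

section \<open>Distances as relation powers\<close>

context wf_digraph begin

lemma awalk_imp_relpow: "awalk u p v \<Longrightarrow> (u, v) \<in> arcs_ends G ^^ length p"
proof (induction p arbitrary: u)
  case Nil
  then show ?case by (simp add: awalk_Nil_iff)
next
  case (Cons e p)
  then have "(u, head G e) \<in> arcs_ends G" "(head G e, v) \<in> arcs_ends G ^^ length p"
    by (auto simp: awalk_Cons_iff arcs_ends_conv)
  then show ?case
    by (simp only: length_Cons) (rule relpow_Suc_I2)
qed

lemma relpow_imp_awalk:
  "(u, v) \<in> arcs_ends G ^^ k \<Longrightarrow> u \<in> verts G \<Longrightarrow> \<exists>p. awalk u p v \<and> length p = k"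
proof (induction k arbitrary: u)
  case 0
  then show ?case by (auto simp: awalk_Nil_iff)
next
  case (Suc k)
  from Suc.prems(1) obtain w where w: "(u, w) \<in> arcs_ends G" "(w, v) \<in> arcs_ends G ^^ k"
    by (blast dest: relpow_Suc_D2)
  then obtain e where e: "e \<in> arcs G" "tail G e = u" "head G e = w" by auto
  with Suc.IH[OF w(2)] obtain p where "awalk w p v" "length p = k" by auto
  with e have "awalk u (e # p) v \<and> length (e # p) = Suc k" by (simp add: awalk_Cons_iff)
  then show ?case by blast
qed

lemma unit_distance_le_iff:
  assumes "u \<in> verts G"
  shows "\<mu> (\<lambda>_. 1) u v \<le> ereal (real k) \<longleftrightarrow> (\<exists>i\<le>k. (u, v) \<in> arcs_ends G ^^ i)"
proof
  have cost: "awalk_cost (\<lambda>_. 1) p = real (length p)" for p :: "'b list"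
    by (induction p) auto
  show "\<mu> (\<lambda>_. 1) u v \<le> ereal (real k)" if "\<exists>i\<le>k. (u, v) \<in> arcs_ends G ^^ i"
  proof -
    from that obtain i where "i \<le> k" "(u, v) \<in> arcs_ends G ^^ i" by blast
    with relpow_imp_awalk[OF _ assms] obtain p where "awalk u p v" "length p \<le> k" by blast
    then show ?thesis
      using min_cost_le_walk_cost[of u p v "\<lambda>_. 1"] by (auto simp: cost intro: order_trans)
  qed
  show "\<exists>i\<le>k. (u, v) \<in> arcs_ends G ^^ i" if "\<mu> (\<lambda>_. 1) u v \<le> ereal (real k)"
  proof -
    \<comment> \<open>An infimum strictly below a number is undercut by a single walk. Lengths are
      integers, so staying below \<open>k + 1\<close> gives back \<open>\<le> k\<close>.\<close>
    have "\<mu> (\<lambda>_. 1) u v < ereal (real k + 1)"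
      using that by (rule le_less_trans) simp
    then obtain p where p: "awalk u p v" "real (length p) < real k + 1"
      unfolding \<mu>_def by (auto simp: INF_less_iff cost)
    then have "length p \<le> k" by linarith
    with awalk_imp_relpow[OF p(1)] show ?thesis by blast
  qed
qed

lemma out_ecc_le_iff:
  assumes "u \<in> verts G"
  shows "out_ecc u \<le> ereal (real k) \<longleftrightarrow> (\<forall>v\<in>verts G. \<exists>i\<le>k. (u, v) \<in> arcs_ends G ^^ i)"
  unfolding out_ecc_def SUP_le_iff using unit_distance_le_iff[OF assms] by simp

end

text \<open>What is used of the outradius later: over a finite set the minimum is attained, which
  supplies the root, and minimality keeps every vertex from reaching all others in fewer than
  \<open>r\<close> steps.\<close>

lemma (in fin_digraph) out_radius_eqD:
  assumes "out_radius = ereal (real r)"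
  shows "\<exists>v\<^sub>0\<in>verts G. \<forall>v\<in>verts G. \<exists>i\<le>r. (v\<^sub>0, v) \<in> arcs_ends G ^^ i"
    and "\<And>u. u \<in> verts G \<Longrightarrow> \<exists>v\<in>verts G. \<forall>i<r. (u, v) \<notin> arcs_ends G ^^ i"
proof -
  \<comment> \<open>The infimum over no vertices would be \<open>\<infinity>\<close>.\<close>
  have ne: "verts G \<noteq> {}"
    using assms by (auto simp: out_radius_def top_ereal_def)
  then have "Inf (out_ecc ` verts G) \<in> out_ecc ` verts G"
    by (simp add: Min_Inf[symmetric])
  then obtain v0 where "v0 \<in> verts G" "out_ecc v0 = ereal (real r)"
    using assms by (auto simp: out_radius_def)
  then show "\<exists>v\<^sub>0\<in>verts G. \<forall>v\<in>verts G. \<exists>i\<le>r. (v\<^sub>0, v) \<in> arcs_ends G ^^ i"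
    using out_ecc_le_iff[of v0 r] by auto
next
  fix u assume u: "u \<in> verts G"
  have le: "ereal (real r) \<le> out_ecc u"
    using assms u by (auto simp: out_radius_def INF_lower simp flip: assms)
  show "\<exists>v\<in>verts G. \<forall>i<r. (u, v) \<notin> arcs_ends G ^^ i"
  proof (cases r)
    case 0
    then show ?thesis using u by auto
  next
    case (Suc k)
    then have "\<not> out_ecc u \<le> ereal (real k)"
      using le order_trans by fastforce
    then show ?thesis
      using out_ecc_le_iff[OF u, of k] Suc by (auto simp: less_Suc_eq_le)
  qed
qed

section \<open>Layerings\<close>

definition layer :: "'a set \<Rightarrow> ('a \<Rightarrow> nat) \<Rightarrow> nat \<Rightarrow> 'a set" where
  "layer V lev i = {x \<in> V. lev x = i}"

text \<open>The pairs that can be arcs when \<open>lev\<close> is the distance from a source.\<close>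

definition layered_pairs :: "'a set \<Rightarrow> ('a \<Rightarrow> nat) \<Rightarrow> ('a \<times> 'a) set" where
  "layered_pairs V lev =
     {(x, y). x \<in> V \<and> y \<in> V \<and> lev y \<noteq> 0 \<and> lev y \<le> lev x + 1 \<and> even (lev x) \<noteq> even (lev y)}"

text \<open>\<open>lev\<close> is the distance from \<open>v\<^sub>0\<close>. Walks alternate
  between \<open>U\<close> and its complement, so the parity of the distance decides the side.
  Together \<open>reach\<close> and \<open>far\<close> make the largest distance exactly
  \<open>r\<close>, and following predecessors down from there fills every level.\<close>

lemma distance_layering:
  fixes R :: "'a rel"
  assumes R: "R \<subseteq> V \<times> V"
    and bip: "\<And>x y. (x, y) \<in> R \<Longrightarrow> (x \<in> U) \<noteq> (y \<in> U)"
    and v0: "v\<^sub>0 \<in> V"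
    and reach: "\<And>v. v \<in> V \<Longrightarrow> \<exists>i\<le>r. (v\<^sub>0, v) \<in> R ^^ i"
    and far: "\<exists>v\<in>V. \<forall>i<r. (v\<^sub>0, v) \<notin> R ^^ i"
  obtains lev where "lev v\<^sub>0 = (0::nat)"
    "\<And>x. x \<in> V \<Longrightarrow> lev x \<le> r"
    "\<And>x. x \<in> V \<Longrightarrow> lev x = 0 \<Longrightarrow> x = v\<^sub>0"
    "\<And>x y. (x, y) \<in> R \<Longrightarrow> lev y \<le> lev x + 1"
    "\<And>x y. (x, y) \<in> R \<Longrightarrow> even (lev x) \<noteq> even (lev y)"
    "\<And>x i. x \<in> V \<Longrightarrow> lev x = Suc i \<Longrightarrow> \<exists>z\<in>V. lev z = i \<and> (z, x) \<in> R"
    "\<And>i. i \<le> r \<Longrightarrow> \<exists>x\<in>V. lev x = i"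
proof -
  define lev where "lev x = (LEAST i. (v\<^sub>0, x) \<in> R ^^ i)" for x
  have lev_le: "lev x \<le> i" if "(v\<^sub>0, x) \<in> R ^^ i" for x i
    unfolding lev_def using that by (rule Least_le)
  have lev: "(v\<^sub>0, x) \<in> R ^^ lev x" if "x \<in> V" for x
    unfolding lev_def using reach[OF that] by (auto intro: LeastI)
  have lev0: "lev v\<^sub>0 = 0" using lev_le[of v\<^sub>0 0] by simp
  have lev_r: "lev x \<le> r" if "x \<in> V" for x
    using reach[OF that] lev_le order_trans by blast
  have lev_step: "lev y \<le> lev x + 1" if "(x, y) \<in> R" for x y
    using lev_le[OF relpow_Suc_I[OF lev that]] that R by auto
  have pred: "\<exists>z\<in>V. lev z = i \<and> (z, x) \<in> R" if "x \<in> V" "lev x = Suc i" for x i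
  proof -
    from lev[OF that(1)] have "(v\<^sub>0, x) \<in> R ^^ Suc i" unfolding that(2) .
    then obtain z where z: "(v\<^sub>0, z) \<in> R ^^ i" "(z, x) \<in> R" by (rule relpow_Suc_E)
    then have "lev z \<le> i" "lev x \<le> lev z + 1" using lev_le lev_step by blast+
    then show ?thesis using z R that(2) by auto
  qed
  have par: "(x \<in> U) = ((v\<^sub>0 \<in> U) = even k)" if "(v\<^sub>0, x) \<in> R ^^ k" for x k
    using that
  proof (induction k arbitrary: x)
    case (Suc k)
    from Suc.prems obtain z where "(v\<^sub>0, z) \<in> R ^^ k" "(z, x) \<in> R" by (rule relpow_Suc_E)
    with Suc.IH[of z] bip[of z x] show ?case by auto
  qed auto
  have parity: "even (lev x) \<noteq> even (lev y)" if "(x, y) \<in> R" for x y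
    using par[OF lev, of x] par[OF lev, of y] bip[OF that] R that by auto
  have all: "\<exists>x\<in>V. lev x = i" if "i \<le> r" for i
    using that
  proof (induction i rule: inc_induct)
    case base
    from far obtain v where v: "v \<in> V" "\<forall>i<r. (v\<^sub>0, v) \<notin> R ^^ i" by blast
    with lev[of v] have "lev v \<ge> r" by (meson not_le)
    with lev_r[OF v(1)] v(1) show ?case by (auto intro: le_antisym)
  next
    case (step i)
    then show ?case using pred by blast
  qed
  show thesis
  proof (rule that[of lev])
    show "x = v\<^sub>0" if "x \<in> V" "lev x = 0" for x using lev[OF that(1)] that(2) by simp
  qed (fact lev0 | erule lev_r | erule lev_step | erule parity | erule (1) pred | erule all)+
qed

text \<open>If \<open>x\<close> had every arc permitted by levels and parity, all vertices would be
  fewer than \<open>r\<close> steps away. Higher ones cost the difference of levels, at most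
  \<open>r - 1\<close> because \<open>x\<close> is not on level 0; the others cost one step, or two
  through a predecessor. Only the root has no predecessor on a lower level; it is reached through
  \<open>z\<close>. Unlike in \<open>layered_pairs\<close>, arcs into the root count as
  permitted.\<close>

lemma missing_pair:
  fixes R :: "'a rel" and lev :: "'a \<Rightarrow> nat"
  assumes lev_r: "\<And>x. x \<in> V \<Longrightarrow> lev x \<le> r"
    and root: "\<And>x. x \<in> V \<Longrightarrow> lev x = 0 \<Longrightarrow> x = v\<^sub>0"
    and lev0: "lev v\<^sub>0 = 0"
    and parity: "\<And>x y. (x, y) \<in> R \<Longrightarrow> even (lev x) \<noteq> even (lev y)"
    and pred: "\<And>x i. x \<in> V \<Longrightarrow> lev x = Suc i \<Longrightarrow> \<exists>z\<in>V. lev z = i \<and> (z, x) \<in> R"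
    and far: "\<exists>v\<in>V. \<forall>i<r. (x, v) \<notin> R ^^ i"
    and r: "3 \<le> r"
    and z: "z \<in> V" "(z, v\<^sub>0) \<in> R"
    and x: "x \<in> V" "x \<noteq> v\<^sub>0"
  shows "\<exists>y\<in>V. lev y \<le> lev x + 1 \<and> even (lev x) \<noteq> even (lev y) \<and> (x, y) \<notin> R"
proof (rule ccontr)
  assume "\<not> ?thesis"
  then have full: "(x, y) \<in> R" if "y \<in> V" "lev y \<le> lev x + 1" "even (lev x) \<noteq> even (lev y)" for y
    using that by blast
  have x_pos: "lev x \<ge> 1" using root[OF x(1)] x(2) by (cases "lev x") auto
  \<comment> \<open>Predecessors are traced back from \<open>v\<close> to level
    \<open>lev x + 1\<close>, where every vertex is an out-neighbour of \<open>x\<close> by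
    \<open>full\<close>.\<close>
  have above: "(x, v) \<in> R ^^ Suc d" if "v \<in> V" "lev v = lev x + Suc d" for v d
    using that
  proof (induction d arbitrary: v)
    case 0
    then show ?case using full[of v] by simp
  next
    case (Suc d)
    then obtain w where "w \<in> V" "lev w = lev x + Suc d" "(w, v) \<in> R"
      using pred[of v "lev x + Suc d"] by auto
    with Suc.IH[of w] show ?case by (blast intro: relpow_Suc_I)
  qed
  have two: "(x, v) \<in> R ^^ 2" if "(x, w) \<in> R" "(w, v) \<in> R" for v w
    using that by (auto simp: numeral_2_eq_2)
  have "\<exists>k<r. (x, v) \<in> R ^^ k" if v: "v \<in> V" for v
  proof (cases "lev v > lev x")
    case True
    then obtain d where d: "lev v = lev x + Suc d" using less_iff_Suc_add by auto
    then have "Suc d < r" using lev_r[OF v] x_pos by linarith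
    with above[OF v d] show ?thesis by blast
  next
    case False
    show ?thesis
    proof (cases "even (lev x) = even (lev v)")
      case False
      then have "(x, v) \<in> R ^^ 1" using full[OF v] \<open>\<not> lev v > lev x\<close> by auto
      with r show ?thesis by (intro exI[of _ 1]) auto
    next
      case same: True
      show ?thesis
      proof (cases "lev v")
        case (Suc i)
        then obtain w where w: "w \<in> V" "lev w = i" "(w, v) \<in> R" using pred[OF v] by blast
        then have "(x, w) \<in> R" using full[of w] Suc False same by auto
        with two w(3) r show ?thesis by (intro exI[of _ 2]) auto
      next
        case 0
        then have v_root: "v = v\<^sub>0" using root[OF v] by simp
        \<comment> \<open>Even and positive, hence at least 2. The spare unit pays for the last arc
          from \<open>z\<close> to the root when \<open>z\<close> lies above
          \<open>x\<close>.\<close>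
        have x_two: "lev x \<ge> 2" using same 0 x_pos by presburger
        have z_odd: "odd (lev z)" using parity[OF z(2)] lev0 by simp
        show ?thesis
        proof (cases "lev z \<le> lev x + 1")
          case True
          then have "(x, z) \<in> R" using full[OF z(1)] z_odd same 0 by simp
          with two z(2) r v_root show ?thesis by (intro exI[of _ 2]) auto
        next
          case False
          then obtain d where d: "lev z = lev x + Suc d"
            using less_iff_Suc_add[of "lev x" "lev z"] by auto
          have "(x, v) \<in> R ^^ Suc (Suc d)"
            using above[OF z(1) d] z(2) v_root by (blast intro: relpow_Suc_I)
          moreover have "Suc (Suc d) < r" using lev_r[OF z(1)] d x_two by linarith
          ultimately show ?thesis by blast
        qed
      qed
    qed
  qed
  then show False using far by blast
qed

text \<open>Opposite parity excludes equal levels, so a pair either falls or climbs. An even and an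
  odd vertex have exactly one falling orientation, and it is forbidden only if it ends in the root:
  this is the product. A climbing pair joins consecutive layers: this is the sum.\<close>

lemma card_layered_pairs:
  fixes lev :: "'a \<Rightarrow> nat"
  assumes fin: "finite V"
    and lev_r: "\<And>x. x \<in> V \<Longrightarrow> lev x \<le> r"
    and one: "card (layer V lev 0) = 1"
  shows "card (layered_pairs V lev) =
    (card {x \<in> V. even (lev x)} - 1) * card {x \<in> V. odd (lev x)}
    + (\<Sum>i<r. card (layer V lev i) * card (layer V lev (Suc i)))"
proof -
  define P where "P = {x \<in> V. even (lev x) \<and> lev x \<noteq> 0}"
  define Q where "Q = {x \<in> V. odd (lev x)}"
  define Back where "Back = {(x, y). x \<in> V \<and> y \<in> V \<and> lev y \<noteq> 0 \<and> lev y < lev x \<and> even (lev x) \<noteq> even (lev y)}"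
  define Fwd where "Fwd = (\<Union>i<r. layer V lev i \<times> layer V lev (Suc i))"
  have fin': "finite P" "finite Q" "finite (layer V lev i)" for i
    using fin by (auto simp: P_def Q_def layer_def)
  have "finite Back"
    by (rule finite_subset[of _ "V \<times> V"]) (auto simp: Back_def fin)
  have "finite Fwd" using fin' by (auto simp: Fwd_def)
  have split: "layered_pairs V lev = Back \<union> Fwd"
  proof (intro equalityI subsetI)
    fix p assume p: "p \<in> layered_pairs V lev"
    obtain x y where xy: "p = (x, y)" by (cases p)
    show "p \<in> Back \<union> Fwd"
    proof (cases "lev y = lev x + 1")
      case True
      then have "lev x < r" using lev_r[of y] p xy by (auto simp: layered_pairs_def)
      with True p xy show ?thesis by (auto simp: layered_pairs_def Fwd_def layer_def)
    next
      case False
      with p xy have "lev y < lev x"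
        by (cases "lev y = lev x") (auto simp: layered_pairs_def)
      with p xy show ?thesis by (auto simp: layered_pairs_def Back_def)
    qed
  next
    fix p assume "p \<in> Back \<union> Fwd"
    then show "p \<in> layered_pairs V lev"
      by (auto simp: layered_pairs_def Back_def Fwd_def layer_def)
  qed
  have "Back \<inter> Fwd = {}" by (auto simp: Back_def Fwd_def layer_def)
  then have "card (layered_pairs V lev) = card Back + card Fwd"
    unfolding split using \<open>finite Back\<close> \<open>finite Fwd\<close> by (simp add: card_Un_disjoint)
  moreover have "card Fwd = (\<Sum>i<r. card (layer V lev i) * card (layer V lev (Suc i)))"
    unfolding Fwd_def
    by (subst card_UN_disjoint) (use fin' in \<open>auto simp: layer_def card_cartesian_product\<close>)
  moreover have "card Back = card (P \<times> Q)"
  proof (rule bij_betw_same_card)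
    \<comment> \<open>\<open>?f\<close> puts the even end first; \<open>?g\<close> recovers the
      falling orientation by comparing levels.\<close>
    let ?f = "\<lambda>(x, y). if even (lev x) then (x, y) else (y, x)"
    let ?g = "\<lambda>(x, y). if lev y < lev x then (x, y) else (y, x)"
    show "bij_betw ?f Back (P \<times> Q)"
    proof (rule bij_betw_byWitness[where f' = ?g])
      show "?f ` Back \<subseteq> P \<times> Q" by (auto simp: Back_def P_def Q_def)
      show "?g ` (P \<times> Q) \<subseteq> Back"
        by (clarsimp simp: Back_def P_def Q_def image_subset_iff) (metis linorder_neqE_nat odd_pos)
    qed (auto simp: Back_def P_def Q_def)
  qed
  moreover have "card {x \<in> V. even (lev x)} = 1 + card P"
  proof -
    have "{x \<in> V. even (lev x)} = layer V lev 0 \<union> P" "layer V lev 0 \<inter> P = {}"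
      by (auto simp: layer_def P_def)
    then show ?thesis using fin' one by (simp add: card_Un_disjoint)
  qed
  ultimately show ?thesis by (simp add: card_cartesian_product Q_def)
qed

section \<open>Layer sizes\<close>

text \<open>With \<open>d = p - q\<close> taken in the integers,
  \<open>(p + q)\<^sup>2 = 4 * (p * q) + d\<^sup>2\<close>. The gap is therefore
  \<open>d\<^sup>2 div 4\<close>, which vanishes exactly for
  \<open>\<bar>d\<bar> < 2\<close>.\<close>

lemma mult_le_balanced:
  fixes p q :: nat
  shows "p * q \<le> (p + q)\<^sup>2 div 4"
    and "p * q = (p + q)\<^sup>2 div 4 \<longleftrightarrow> \<bar>int p - int q\<bar> \<le> 1"
proof -
  define d where "d = int p - int q"
  have "(int p + int q)\<^sup>2 = d\<^sup>2 + 4 * (int p * int q)"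
    unfolding d_def by (simp add: power2_eq_square algebra_simps)
  then have eq: "int ((p + q)\<^sup>2 div 4) = int (p * q) + d\<^sup>2 div 4"
    by (simp add: zdiv_int)
  moreover have "d\<^sup>2 div 4 \<ge> 0" by (simp add: pos_imp_zdiv_nonneg_iff)
  ultimately show "p * q \<le> (p + q)\<^sup>2 div 4" by linarith
  have "d\<^sup>2 div 4 = 0 \<longleftrightarrow> \<bar>d\<bar> < 2"
    using abs_le_square_iff[of 2 d] \<open>d\<^sup>2 div 4 \<ge> 0\<close> by auto
  then show "p * q = (p + q)\<^sup>2 div 4 \<longleftrightarrow> \<bar>int p - int q\<bar> \<le> 1"
    using eq unfolding d_def by linarith
qed

lemma sum_parity_split:
  fixes x :: "nat \<Rightarrow> nat"
  shows "sum x {i. i \<le> r \<and> even i} + sum x {i. i \<le> r \<and> odd i} = sum x {..r}"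
proof -
  have "{..r} = {i. i \<le> r \<and> even i} \<union> {i. i \<le> r \<and> odd i}" by auto
  then show ?thesis by (simp only:) (rule sum.union_disjoint[symmetric], auto)
qed

lemma card_parity:
  shows card_even_le: "card {i. i \<le> r \<and> even i} = r div 2 + 1"
    and card_odd_le: "card {i. i \<le> r \<and> odd i} = (r + 1) div 2"
proof -
  have "bij_betw (\<lambda>i. 2 * i) {..r div 2} {i. i \<le> r \<and> even i}"
    by (rule bij_betw_byWitness[where f' = "\<lambda>i. i div 2"]) auto
  then show *: "card {i. i \<le> r \<and> even i} = r div 2 + 1"
    by (simp add: bij_betw_same_card[symmetric])
  show "card {i. i \<le> r \<and> odd i} = (r + 1) div 2"
    using sum_parity_split[of "\<lambda>_. 1" r] * by simp
qed

text \<open>The product of the two sums expands over all pairs of an even and an odd index. The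
  consecutive pairs occur in it once each, so the difference is the sum over the remaining pairs,
  and equality means that all of those terms vanish.\<close>

lemma consecutive_products:
  fixes x :: "nat \<Rightarrow> nat" and r :: nat
  defines "E \<equiv> {i. i \<le> r \<and> even i}" and "Od \<equiv> {i. i \<le> r \<and> odd i}"
  shows "(\<Sum>i<r. x i * x (Suc i)) \<le> sum x E * sum x Od"
    and "(\<Sum>i<r. x i * x (Suc i)) = sum x E * sum x Od \<longleftrightarrow>
      (\<forall>i\<in>E. \<forall>k\<in>Od. i \<noteq> Suc k \<longrightarrow> k \<noteq> Suc i \<longrightarrow> x i = 0 \<or> x k = 0)"
proof -
  define N where "N = {(i, k). i \<in> E \<and> k \<in> Od \<and> (i = Suc k \<or> k = Suc i)}"
  have fin: "finite (E \<times> Od)" and N: "N \<subseteq> E \<times> Od"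
    by (auto simp: E_def Od_def N_def)
  \<comment> \<open>Each step from \<open>i\<close> to \<open>Suc i\<close> is written with its even
    end first; the minimum of the pair recovers \<open>i\<close>.\<close>
  have "bij_betw (\<lambda>i. if even i then (i, Suc i) else (Suc i, i)) {..<r} N"
    by (rule bij_betw_byWitness[where f' = "\<lambda>(i, k). min i k"])
      (auto simp: N_def E_def Od_def)
  then have "(\<Sum>(i, k)\<in>N. x i * x k) =
      (\<Sum>j<r. case (if even j then (j, Suc j) else (Suc j, j)) of (i, k) \<Rightarrow> x i * x k)"
    by (rule sum.reindex_bij_betw[symmetric])
  also have "\<dots> = (\<Sum>j<r. x j * x (Suc j))"
    by (rule sum.cong) auto
  finally have "(\<Sum>(i, k)\<in>E \<times> Od. x i * x k) =
      (\<Sum>(i, k)\<in>E \<times> Od - N. x i * x k) + (\<Sum>j<r. x j * x (Suc j))"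
    using sum.subset_diff[OF N fin] by metis
  then have split: "sum x E * sum x Od =
      (\<Sum>(i, k)\<in>E \<times> Od - N. x i * x k) + (\<Sum>j<r. x j * x (Suc j))"
    by (simp add: sum_product sum.cartesian_product)
  then show "(\<Sum>i<r. x i * x (Suc i)) \<le> sum x E * sum x Od" by simp
  have "(\<Sum>(i, k)\<in>E \<times> Od - N. x i * x k) = 0 \<longleftrightarrow>
      (\<forall>(i, k)\<in>E \<times> Od - N. x i * x k = 0)"
    using fin by (subst sum_eq_0_iff) (auto simp: split_beta)
  also have "\<dots> \<longleftrightarrow> (\<forall>i\<in>E. \<forall>k\<in>Od. i \<noteq> Suc k \<longrightarrow> k \<noteq> Suc i \<longrightarrow> x i = 0 \<or> x k = 0)"
    by (simp add: N_def Ball_def) metis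
  finally have "(\<Sum>(i, k)\<in>E \<times> Od - N. x i * x k) = 0 \<longleftrightarrow>
      (\<forall>i\<in>E. \<forall>k\<in>Od. i \<noteq> Suc k \<longrightarrow> k \<noteq> Suc i \<longrightarrow> x i = 0 \<or> x k = 0)" .
  with split show "(\<Sum>i<r. x i * x (Suc i)) = sum x E * sum x Od \<longleftrightarrow>
      (\<forall>i\<in>E. \<forall>k\<in>Od. i \<noteq> Suc k \<longrightarrow> k \<noteq> Suc i \<longrightarrow> x i = 0 \<or> x k = 0)"
    by linarith
qed

text \<open>Expanding yields every \<open>x i\<close> twice, except that the two ends each lack one
  occurrence. They are added on the left because subtraction would be truncated.\<close>

lemma sum_Suc_products:
  fixes x :: "nat \<Rightarrow> nat"
  shows "(\<Sum>i<r. Suc (x i) * Suc (x (Suc i))) + x 0 + x r =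
    r + 2 * sum x {..r} + (\<Sum>i<r. x i * x (Suc i))"
  by (induction r) (auto simp: algebra_simps)

lemma sum_supported_on_three:
  fixes x :: "nat \<Rightarrow> nat"
  assumes j: "j + 2 \<le> r"
    and supp: "\<And>i. i \<le> r \<Longrightarrow> i \<notin> {j, j + 1, j + 2} \<Longrightarrow> x i = 0"
  shows "sum x {..r} = x j + x (j + 1) + x (j + 2)"
    and "sum x {i. i \<le> r \<and> even i} = (if even j then x j + x (j + 2) else x (j + 1))"
    and "sum x {i. i \<le> r \<and> odd i} = (if even j then x (j + 1) else x j + x (j + 2))"
proof -
  have supp': "i = j \<or> i = j + 1 \<or> i = j + 2" if "0 < x i" "i \<le> r" for i
    using supp[of i] that by auto
  have "sum x {..r} = sum x {j, j + 1, j + 2}"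
    by (rule sum.mono_neutral_right) (use j supp in auto)
  then show "sum x {..r} = x j + x (j + 1) + x (j + 2)" by simp
  have "sum x {i. i \<le> r \<and> even i} = sum x (if even j then {j, j + 2} else {j + 1})"
    by (rule sum.mono_neutral_right) (use j in \<open>auto split: if_splits dest: supp'\<close>)
  then show "sum x {i. i \<le> r \<and> even i} = (if even j then x j + x (j + 2) else x (j + 1))"
    by auto
  have "sum x {i. i \<le> r \<and> odd i} = sum x (if even j then {j + 1} else {j, j + 2})"
    by (rule sum.mono_neutral_right) (use j in \<open>auto split: if_splits dest: supp'\<close>)
  then show "sum x {i. i \<le> r \<and> odd i} = (if even j then x (j + 1) else x j + x (j + 2))"
    by auto
qed

text \<open>Suppose the smallest and the largest positive index are more than 2 apart. They then
  have equal parity, and a positive index of the other parity would have to be next to both. So all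
  the weight, at least 2, lies on one parity, against \<open>bal\<close>.\<close>

lemma support_in_three_consecutive:
  fixes x :: "nat \<Rightarrow> nat"
  assumes r: "3 \<le> r" and ends: "x 0 = 0" "x r = 0"
    and adj: "\<And>i k. i \<le> r \<Longrightarrow> k \<le> r \<Longrightarrow> even i \<noteq> even k \<Longrightarrow> x i > 0 \<Longrightarrow> x k > 0 \<Longrightarrow>
      i = Suc k \<or> k = Suc i"
    and bal: "\<bar>int (sum x {i. i \<le> r \<and> even i}) - int (sum x {i. i \<le> r \<and> odd i})\<bar> \<le> 1"
  obtains j where "1 \<le> j" "j + 2 \<le> r - 1 \<or> r = 3 \<and> j = 1"
    "\<And>i. i \<le> r \<Longrightarrow> i \<notin> {j, j + 1, j + 2} \<Longrightarrow> x i = 0"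
\<comment> \<open>The cases in which the window can be fixed at \<open>j = 1\<close>: for
  \<open>r = 3\<close> it covers all indices but 0, and for \<open>x = 0\<close> any window
  serves.\<close>
proof (cases "r = 3 \<or> (\<forall>i\<le>r. x i = 0)")
  case True
  show thesis
  proof (rule that[of 1])
    show "1 + 2 \<le> r - 1 \<or> r = 3 \<and> (1::nat) = 1" using r by linarith
    show "x i = 0" if "i \<le> r" "i \<notin> {1, 1 + 1, 1 + 2}" for i
    proof (cases "i = 0")
      case False
      with that True show ?thesis by auto
    qed (simp add: ends)
  qed simp
next
  case False
  define S where "S = {i. i \<le> r \<and> x i > 0}"
  have S: "finite S" "S \<noteq> {}" using False by (auto simp: S_def)
  define m M where "m = Min S" and "M = Max S"
  have mM: "m \<in> S" "M \<in> S" using S by (auto simp: m_def M_def)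
  have between: "m \<le> i" "i \<le> M" if "i \<in> S" for i
    using that S by (auto simp: m_def M_def)
  have pos: "0 < i" "i < r" if "i \<in> S" for i
    using that ends by (auto simp: S_def intro: gr0I le_neq_trans)
  have "M \<le> m + 2"
  proof (rule ccontr)
    assume far: "\<not> M \<le> m + 2"
    have par: "even m = even M"
      using adj[of m M] mM far by (auto simp: S_def)
    have zero: "x k = 0" if "k \<le> r" "even k \<noteq> even m" for k
      using adj[of m k] adj[of M k] that mM far par by (cases "x k = 0") (auto simp: S_def)
    let ?A = "{i. i \<le> r \<and> even i = even m}" and ?B = "{i. i \<le> r \<and> even i \<noteq> even m}"
    have "sum x ?B = 0" using zero by simp
    moreover have "sum x {m, M} \<le> sum x ?A"
      by (rule sum_mono2) (use mM par in \<open>auto simp: S_def\<close>)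
    then have "2 \<le> sum x ?A" using mM far by (auto simp: S_def)
    ultimately show False using bal by (cases "even m") (simp_all del: of_nat_sum)
  qed
  show thesis
  \<comment> \<open>The window starts at the smallest positive index unless it would then run past
    \<open>r - 1\<close>. Shifting it left loses nothing, as the support stays below
    \<open>r\<close>.\<close>
  proof (rule that[of "min m (r - 3)"])
    show "1 \<le> min m (r - 3)" using pos[OF mM(1)] False r by auto
    show "min m (r - 3) + 2 \<le> r - 1 \<or> r = 3 \<and> min m (r - 3) = 1" using r by linarith
    show "x i = 0" if "i \<le> r" "i \<notin> {min m (r - 3), min m (r - 3) + 1, min m (r - 3) + 2}" for i
    proof (rule ccontr)
      assume "x i \<noteq> 0"
      then have "i \<in> S" using that by (simp add: S_def)
      with between[of i] pos[of i] \<open>M \<le> m + 2\<close> r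
      have "min m (r - 3) \<le> i" "i \<le> min m (r - 3) + 2" by linarith+
      with that(2) show False by auto
    qed
  qed
qed

section \<open>Maximizing the number of layered pairs over the layer sizes\<close>

definition blow_up_sizes :: "nat \<Rightarrow> nat \<Rightarrow> nat \<Rightarrow> nat \<Rightarrow> nat \<Rightarrow> nat" where
  "blow_up_sizes j a b c = (\<lambda>_. 1)(j := a, j + 1 := b, j + 2 := c)"

text \<open>In the excesses \<open>x i = l i - 1\<close> the bound is a sum of separate estimates:
  \<open>(P - 1) * Q\<close> by its balanced value, \<open>W\<close> by \<open>E * F\<close> and
  that by its balanced value, and \<open>- x r\<close> by 0. Equality forces all of them to be tight
  at once; these conditions together describe the blow-up sizes.\<close>

lemma layer_sizes_optimum:
  fixes l :: "nat \<Rightarrow> nat" and r n :: nat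
  assumes r: "3 \<le> r" and l0: "l 0 = 1" and l_pos: "\<And>i. i \<le> r \<Longrightarrow> 0 < l i"
    and n: "n = sum l {..r}"
  defines "P \<equiv> sum l {i. i \<le> r \<and> even i}" and "Q \<equiv> sum l {i. i \<le> r \<and> odd i}"
  shows "r + 1 \<le> n"
    and "(P - 1) * Q + (\<Sum>i<r. l i * l (Suc i)) \<le>
      (n - 1)\<^sup>2 div 4 + ((n - r - 1)\<^sup>2 div 4 + 2 * (n - r - 1) + r)" (is "?le")
    and "(P - 1) * Q + (\<Sum>i<r. l i * l (Suc i)) =
      (n - 1)\<^sup>2 div 4 + ((n - r - 1)\<^sup>2 div 4 + 2 * (n - r - 1) + r) \<longleftrightarrow>
      (\<exists>j a b c. blow_up_position r j c \<and> 0 < a \<and> 0 < b \<and> 0 < c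
        \<and> int a + int b + int c = int n - int r + 2
        \<and> \<bar>int a + int c - (int b + 1)\<bar> \<le> 1
        \<and> (odd r \<longrightarrow> Q \<le> P)
        \<and> (\<forall>i\<le>r. l i = blow_up_sizes j a b c i))" (is "?eq \<longleftrightarrow> ?shape")
proof -
  define x where "x i = l i - 1" for i
  have l: "l i = Suc (x i)" if "i \<le> r" for i using l_pos[OF that] by (simp add: x_def)
  define X where "X = sum x {..r}"
  define W where "W = (\<Sum>i<r. x i * x (Suc i))"
  define E where "E = sum x {i. i \<le> r \<and> even i}"
  define F where "F = sum x {i. i \<le> r \<and> odd i}"
  have x0: "x 0 = 0" using l0 by (simp add: x_def)
  have "n = (\<Sum>i\<le>r. Suc (x i))" unfolding n by (rule sum.cong) (auto simp: l)
  then have n_eq: "n = r + 1 + X" by (simp add: X_def sum_Suc)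
  then show "r + 1 \<le> n" by simp
  have X: "n - r - 1 = X" using n_eq by simp
  have "P = (\<Sum>i | i \<le> r \<and> even i. Suc (x i))" unfolding P_def by (rule sum.cong) (auto simp: l)
  then have P: "P = E + r div 2 + 1" by (simp add: E_def sum_Suc card_even_le)
  have "Q = (\<Sum>i | i \<le> r \<and> odd i. Suc (x i))" unfolding Q_def by (rule sum.cong) (auto simp: l)
  then have Q: "Q = F + (r + 1) div 2" by (simp add: F_def sum_Suc card_odd_le)
  have EF: "E + F = X" using sum_parity_split by (simp add: E_def F_def X_def)
  have PQ: "(P - 1) + Q = n - 1" using P Q EF n_eq by simp
  have "(\<Sum>i<r. l i * l (Suc i)) = (\<Sum>i<r. Suc (x i) * Suc (x (Suc i)))"
    by (rule sum.cong) (auto simp: l)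
  with sum_Suc_products[of x r] x0
  have S: "(\<Sum>i<r. l i * l (Suc i)) + x r = r + 2 * X + W"
    by (simp add: X_def W_def)
  have ineqs: "(P - 1) * Q \<le> (n - 1)\<^sup>2 div 4" "W \<le> E * F" "E * F \<le> X\<^sup>2 div 4"
    using mult_le_balanced(1)[of "P - 1" Q] mult_le_balanced(1)[of E F]
      consecutive_products(1)[of x r]
    unfolding PQ EF by (simp_all add: W_def E_def F_def)
  with S show ?le unfolding X by linarith
  have "?eq \<longleftrightarrow> (P - 1) * Q = (n - 1)\<^sup>2 div 4 \<and> W = E * F \<and> E * F = X\<^sup>2 div 4 \<and> x r = 0"
    using ineqs S unfolding X by linarith
  also have "\<dots> \<longleftrightarrow> \<bar>int (P - 1) - int Q\<bar> \<le> 1 \<and> W = E * F \<and> \<bar>int E - int F\<bar> \<le> 1 \<and> x r = 0"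
    using mult_le_balanced(2)[of "P - 1" Q] mult_le_balanced(2)[of E F] unfolding PQ EF by simp
  also have "\<dots> \<longleftrightarrow> (odd r \<longrightarrow> Q \<le> P) \<and> W = E * F \<and> \<bar>int E - int F\<bar> \<le> 1 \<and> x r = 0"
  \<comment> \<open>For even \<open>r\<close> the balance of \<open>P - 1\<close> and
    \<open>Q\<close> repeats that of \<open>E\<close> and \<open>F\<close>. For odd \<open>r\<close>
    the difference is shifted to \<open>E - F - 1\<close>, so both balances hold only if
    \<open>E - F\<close> is 0 or 1, which is where \<open>Q \<le> P\<close> comes from.\<close>
  proof (cases "even r")
    case True
    then have "int (P - 1) - int Q = int E - int F" using P Q by (auto elim!: evenE)
    then show ?thesis using True by auto
  next
    case False
    then have "int (P - 1) - int Q = int E - int F - 1" "int P - int Q = int E - int F"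
      using P Q by (auto elim!: oddE)
    then show ?thesis using False by auto
  qed
  also have "\<dots> \<longleftrightarrow> ?shape"
  proof
    assume *: "(odd r \<longrightarrow> Q \<le> P) \<and> W = E * F \<and> \<bar>int E - int F\<bar> \<le> 1 \<and> x r = 0"
    then have "\<forall>i\<in>{i. i \<le> r \<and> even i}. \<forall>k\<in>{i. i \<le> r \<and> odd i}.
        i \<noteq> Suc k \<longrightarrow> k \<noteq> Suc i \<longrightarrow> x i = 0 \<or> x k = 0"
      using consecutive_products(2)[of x r] by (simp add: W_def E_def F_def)
    then have adj: "i = Suc k \<or> k = Suc i"
      if "i \<le> r" "k \<le> r" "even i \<noteq> even k" "x i > 0" "x k > 0" for i k
      using that by (cases "even i") force+
    obtain j where j: "1 \<le> j" "j + 2 \<le> r - 1 \<or> r = 3 \<and> j = 1"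
      and supp: "\<And>i. i \<le> r \<Longrightarrow> i \<notin> {j, j + 1, j + 2} \<Longrightarrow> x i = 0"
      using support_in_three_consecutive[of r x] r x0 * adj
      unfolding E_def F_def by blast
    have j2: "j + 2 \<le> r" using j r by linarith
    note sums = sum_supported_on_three[where x = x, OF j2 supp, folded E_def F_def X_def]
    show ?shape
    proof (intro exI conjI)
      \<comment> \<open>For \<open>r = 3\<close> the window ends at \<open>r\<close>, and
        \<open>x r = 0\<close> makes the third size 1.\<close>
      show "blow_up_position r j (l (j + 2))"
        using j * l[of 3] by (auto simp: blow_up_position_def numeral_3_eq_3)
      show "0 < l j" "0 < l (j + 1)" "0 < l (j + 2)" using l_pos j2 by auto
      show "int (l j) + int (l (j + 1)) + int (l (j + 2)) = int n - int r + 2"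
        using sums(1) n_eq j2 l[of j] l[of "j + 1"] l[of "j + 2"] by simp
      \<comment> \<open>In terms of excesses this difference is
        \<open>x j + x (j + 2) - x (j + 1)\<close>, which is \<open>E - F\<close> up to a sign
        depending on the parity of \<open>j\<close>.\<close>
      show "\<bar>int (l j) + int (l (j + 2)) - (int (l (j + 1)) + 1)\<bar> \<le> 1"
        using * sums(2,3) j2 l[of j] l[of "j + 1"] l[of "j + 2"]
        by (auto split: if_splits)
      show "odd r \<longrightarrow> Q \<le> P" using * by blast
      show "\<forall>i\<le>r. l i = blow_up_sizes j (l j) (l (j + 1)) (l (j + 2)) i"
        using supp l by (auto simp: blow_up_sizes_def)
    qed
  next
    assume ?shape
    then obtain j a b c where j: "blow_up_position r j c"
      and bal: "\<bar>int a + int c - (int b + 1)\<bar> \<le> 1" and par: "odd r \<longrightarrow> Q \<le> P"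
      and shape: "\<And>i. i \<le> r \<Longrightarrow> l i = blow_up_sizes j a b c i" by blast
    have j2: "j + 2 \<le> r" using j r by (auto simp: blow_up_position_def)
    have supp: "x i = 0" if "i \<le> r" "i \<notin> {j, j + 1, j + 2}" for i
      using shape[OF that(1)] that by (simp add: x_def blow_up_sizes_def)
    have abc: "a = Suc (x j)" "b = Suc (x (j + 1))" "c = Suc (x (j + 2))"
      using shape[of j] shape[of "j + 1"] shape[of "j + 2"] j2 l[of j] l[of "j + 1"] l[of "j + 2"]
      by (simp_all add: blow_up_sizes_def)
    note sums = sum_supported_on_three[where x = x, OF j2 supp, folded E_def F_def X_def]
    have "\<bar>int E - int F\<bar> \<le> 1"
      using bal sums(2,3) abc by (auto split: if_splits)
    moreover have "W = E * F"
    proof -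
      \<comment> \<open>Two indices of opposite parity among three consecutive ones are
        neighbours.\<close>
      have "x i = 0 \<or> x k = 0" if "i \<le> r" "k \<le> r" "even i" "odd k" "i \<noteq> Suc k" "k \<noteq> Suc i" for i k
      proof (rule ccontr)
        assume "\<not> ?thesis"
        then have "i \<in> {j, j + 1, j + 2}" "k \<in> {j, j + 1, j + 2}"
          using supp[OF that(1)] supp[OF that(2)] by metis+
        with that(3-) show False by (elim insertE emptyE) simp_all
      qed
      then show ?thesis
        using consecutive_products(2)[of x r] by (simp add: W_def E_def F_def)
    qed
    moreover have "x r = 0"
    \<comment> \<open>The window can reach \<open>r\<close> only in the degenerate position for
      \<open>r = 3\<close>, which prescribes \<open>c = 1\<close>.\<close>
    proof (cases "r = j + 2")
      case True
      with j r have "c = 1" by (auto simp: blow_up_position_def)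
      with abc(3) True show ?thesis by simp
    next
      case False
      with j2 show ?thesis by (intro supp) auto
    qed
    ultimately show "(odd r \<longrightarrow> Q \<le> P) \<and> W = E * F \<and> \<bar>int E - int F\<bar> \<le> 1 \<and> x r = 0"
      using par by blast
  qed
  finally show "?eq \<longleftrightarrow> ?shape" .
qed

text \<open>With \<open>X = n - r - 1\<close>, the floor splits off \<open>2 * X + 4\<close> from
  \<open>(X + 4)\<^sup>2 div 4\<close>, and this 4 cancels the \<open>- 4\<close>. For the ceiling,
  \<open>n * (n - 2) = (n - 1)\<^sup>2 - 1\<close>; squares are 0 or 1 modulo 4, and in both cases
  rounding up gives \<open>(n - 1)\<^sup>2 div 4\<close>.\<close>

lemma bound_as_integer:
  assumes "r + 1 \<le> n"
  shows "\<lceil>real n * (real n - 2) / 4\<rceil> + int r - 4 + \<lfloor>(real n - real r + 3)\<^sup>2 / 4\<rfloor> =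
    int ((n - 1)\<^sup>2 div 4 + ((n - r - 1)\<^sup>2 div 4 + 2 * (n - r - 1) + r))"
proof -
  define X where "X = n - r - 1"
  have X: "n = X + r + 1" using assms by (simp add: X_def)
  have "(real n - real r + 3)\<^sup>2 = real ((X + 4)\<^sup>2)" by (simp add: X add_ac)
  then have "\<lfloor>(real n - real r + 3)\<^sup>2 / 4\<rfloor> = int ((X + 4)\<^sup>2 div 4)"
    using floor_divide_of_nat_eq[of "(X + 4)\<^sup>2" 4, where ?'a = real] by simp
  moreover have "(X + 4)\<^sup>2 = X\<^sup>2 + (2 * X + 4) * 4" by (simp add: power2_eq_square algebra_simps)
  then have "(X + 4)\<^sup>2 div 4 = X\<^sup>2 div 4 + 2 * X + 4" by simp
  moreover have "\<lceil>real n * (real n - 2) / 4\<rceil> = int ((n - 1)\<^sup>2 div 4)"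
  proof -
    define m where "m = n - 1"
    have m: "real n = real m + 1" using assms by (simp add: m_def)
    have r4: "real (m\<^sup>2) = 4 * real (m\<^sup>2 div 4) + real (m\<^sup>2 mod 4)"
      by (metis mult_div_mod_eq of_nat_add of_nat_mult of_nat_numeral)
    have "m\<^sup>2 mod 4 = (m mod 4)\<^sup>2 mod 4" by (simp add: power_mod)
    moreover have "m mod 4 \<in> {0, 1, 2, 3}" by auto
    ultimately have "m\<^sup>2 mod 4 = 0 \<or> m\<^sup>2 mod 4 = 1" by auto
    moreover have "real n * (real n - 2) = real (m\<^sup>2) - 1"
      by (simp add: m power2_eq_square algebra_simps)
    ultimately have "\<lceil>real n * (real n - 2) / 4\<rceil> = int (m\<^sup>2 div 4)"
      unfolding ceiling_eq_iff using r4 by auto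
    then show ?thesis by (simp add: m_def)
  qed
  ultimately show ?thesis by (simp add: X_def)
qed

lemma card_levels:
  assumes "finite V" and "\<And>x. x \<in> V \<Longrightarrow> lev x \<le> (r::nat)"
  shows "card {x \<in> V. Q (lev x)} = (\<Sum>i | i \<le> r \<and> Q i. card (layer V lev i))"
proof -
  have "{x \<in> V. Q (lev x)} = (\<Union>i\<in>{i. i \<le> r \<and> Q i}. layer V lev i)"
    using assms(2) by (auto simp: layer_def)
  then show ?thesis
    using assms(1) by (simp only:) (subst card_UN_disjoint, auto simp: layer_def)
qed

text \<open>Serves twice: for the distance layering of the given digraph, and for a blow-up of
  \<open>H_digraph r\<close> with the index \<open>fst\<close> as level.\<close>

lemma layered_pairs_optimum:
  fixes lev :: "'a \<Rightarrow> nat" and r n :: nat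
  assumes r: "3 \<le> r" and fin: "finite V" and n: "n = card V"
    and lev_r: "\<forall>x\<in>V. lev x \<le> r"
    and one: "card (layer V lev 0) = 1"
    and pos: "\<forall>i\<le>r. 0 < card (layer V lev i)"
  defines "N \<equiv> (n - 1)\<^sup>2 div 4 + ((n - r - 1)\<^sup>2 div 4 + 2 * (n - r - 1) + r)"
  shows "r + 1 \<le> n"
    and "card (layered_pairs V lev) \<le> N"
    and "card (layered_pairs V lev) = N \<longleftrightarrow>
      (\<exists>j a b c. blow_up_position r j c \<and> 0 < a \<and> 0 < b \<and> 0 < c
        \<and> int a + int b + int c = int n - int r + 2
        \<and> \<bar>int a + int c - (int b + 1)\<bar> \<le> 1
        \<and> (odd r \<longrightarrow> card {x \<in> V. odd (lev x)} \<le> card {x \<in> V. even (lev x)})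
        \<and> (\<forall>i\<le>r. card (layer V lev i) = blow_up_sizes j a b c i))"
proof -
  have levels: "card {x \<in> V. Q (lev x)} = (\<Sum>i | i \<le> r \<and> Q i. card (layer V lev i))" for Q
    by (rule card_levels) (use fin lev_r in auto)
  have sum_n: "n = (\<Sum>i\<le>r. card (layer V lev i))"
    using levels[of "\<lambda>_. True"] n by (simp add: atMost_def)
  have pairs: "card (layered_pairs V lev) =
      (card {x \<in> V. even (lev x)} - 1) * card {x \<in> V. odd (lev x)}
      + (\<Sum>i<r. card (layer V lev i) * card (layer V lev (Suc i)))"
    by (rule card_layered_pairs) (use fin lev_r one in auto)
  note opt = layer_sizes_optimum[where l = "\<lambda>i. card (layer V lev i)", OF r one _ sum_n]
  show "r + 1 \<le> n" by (rule opt(1)) (use pos in auto)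
  show "card (layered_pairs V lev) \<le> N"
    unfolding N_def pairs levels[of even] levels[of "\<lambda>i. odd i"] by (rule opt(2)) (use pos in auto)
  show "card (layered_pairs V lev) = N \<longleftrightarrow>
      (\<exists>j a b c. blow_up_position r j c \<and> 0 < a \<and> 0 < b \<and> 0 < c
        \<and> int a + int b + int c = int n - int r + 2
        \<and> \<bar>int a + int c - (int b + 1)\<bar> \<le> 1
        \<and> (odd r \<longrightarrow> card {x \<in> V. odd (lev x)} \<le> card {x \<in> V. even (lev x)})
        \<and> (\<forall>i\<le>r. card (layer V lev i) = blow_up_sizes j a b c i))"
    unfolding N_def pairs levels[of even] levels[of "\<lambda>i. odd i"] by (rule opt(3)) (use pos in auto)
qed

section \<open>Blow-ups\<close>

text \<open>For \<open>i = 0\<close> the conditions leave only \<open>k = 1\<close>, so the special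
  arc at 0 obeys the same rule as the others. It is the rule of \<open>layered_pairs\<close> with
  the index as level.\<close>

lemma arcs_H_digraph:
  assumes "1 \<le> r"
  shows "arcs (H_digraph r) =
    {(i, k). i \<le> r \<and> k \<le> r \<and> k \<noteq> 0 \<and> k \<le> i + 1 \<and> even i \<noteq> even k}"
proof (intro equalityI subsetI)
  fix p assume "p \<in> {(i, k). i \<le> r \<and> k \<le> r \<and> k \<noteq> 0 \<and> k \<le> i + 1 \<and> even i \<noteq> even k}"
  then obtain i k where "p = (i, k)" "i \<le> r" "k \<le> r" "k \<noteq> 0" "k \<le> i + 1" "even i \<noteq> even k" by blast
  moreover from this have "i = 0 \<Longrightarrow> k = 1" "i \<noteq> k" by auto
  ultimately show "p \<in> arcs (H_digraph r)"
    by (cases "i = 0") (auto simp: H_digraph_def Gamma_star_def)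
qed (use assms in \<open>auto simp: H_digraph_def Gamma_star_def\<close>)

lemma H_blow_up_sel:
  shows verts_H_blow_up: "verts (H_blow_up r j a b c) =
      {(i, k). i \<le> r \<and> k < blow_up_sizes j a b c i}"
    and arcs_H_blow_up: "1 \<le> r \<Longrightarrow> arcs (H_blow_up r j a b c) =
      {((i, i'), k, k'). i \<le> r \<and> i' \<le> r \<and> i' \<noteq> 0 \<and> i' \<le> i + 1 \<and> even i \<noteq> even i'
        \<and> k < blow_up_sizes j a b c i \<and> k' < blow_up_sizes j a b c i'}"
    and tail_H_blow_up: "tail (H_blow_up r j a b c) = (\<lambda>((i, i'), k, k'). (i, k))"
    and head_H_blow_up: "head (H_blow_up r j a b c) = (\<lambda>((i, i'), k, k'). (i', k'))"
proof -
  have sel: "verts (H_digraph r) = {0..r}" "tail (H_digraph r) = fst" "head (H_digraph r) = snd"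
    by (simp_all add: H_digraph_def Gamma_star_def)
  have B: "H_blow_up r j a b c = blow_up (H_digraph r) (blow_up_sizes j a b c)"
    by (simp only: H_blow_up_def blow_up_sizes_def)
  show "verts (H_blow_up r j a b c) = {(i, k). i \<le> r \<and> k < blow_up_sizes j a b c i}"
    by (simp add: B blow_up_def sel)
  show "arcs (H_blow_up r j a b c) =
      {((i, i'), k, k'). i \<le> r \<and> i' \<le> r \<and> i' \<noteq> 0 \<and> i' \<le> i + 1 \<and> even i \<noteq> even i'
        \<and> k < blow_up_sizes j a b c i \<and> k' < blow_up_sizes j a b c i'}" if "1 \<le> r"
    by (auto simp: B blow_up_def sel arcs_H_digraph[OF that])
  show "tail (H_blow_up r j a b c) = (\<lambda>((i, i'), k, k'). (i, k))"
    "head (H_blow_up r j a b c) = (\<lambda>((i, i'), k, k'). (i', k'))"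
    by (auto simp: B blow_up_def sel fun_eq_iff)
qed

lemma card_layer_H_blow_up:
  assumes "i \<le> r"
  shows "card (layer (verts (H_blow_up r j a b c)) fst i) = blow_up_sizes j a b c i"
proof -
  have "layer (verts (H_blow_up r j a b c)) fst i = {i} \<times> {..<blow_up_sizes j a b c i}"
    using assms by (auto simp: layer_def verts_H_blow_up)
  then show ?thesis by (simp add: card_cartesian_product)
qed

lemma finite_verts_H_blow_up: "finite (verts (H_blow_up r j a b c))"
proof -
  have "verts (H_blow_up r j a b c) = (SIGMA i:{..r}. {..<blow_up_sizes j a b c i})"
    by (auto simp: verts_H_blow_up)
  then show ?thesis by simp
qed

text \<open>Regrouping the base arc and the two copy numbers gives the two ends, and every layered
  pair arises exactly once.\<close>

lemma card_arcs_H_blow_up: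
  assumes "1 \<le> r"
  shows "card (arcs (H_blow_up r j a b c)) = card (layered_pairs (verts (H_blow_up r j a b c)) fst)"
proof (rule bij_betw_same_card)
  show "bij_betw (\<lambda>((i, i'), k, k'). ((i, k), (i', k'))) (arcs (H_blow_up r j a b c))
      (layered_pairs (verts (H_blow_up r j a b c)) fst)"
    by (rule bij_betw_byWitness[where f' = "\<lambda>((i, k), (i', k')). ((i, i'), k, k')"])
      (auto simp: arcs_H_blow_up[OF assms] verts_H_blow_up layered_pairs_def)
qed

text \<open>Once all layered pairs are present, adjacency depends on levels alone. Numbering each
  layer arbitrarily therefore sends its vertices to the copies of one index and respects arcs in
  both directions.\<close>

lemma (in digraph) iso_H_blow_upI:
  assumes lev_r: "\<And>x. x \<in> verts G \<Longrightarrow> lev x \<le> r"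
    and sizes: "\<And>i. i \<le> r \<Longrightarrow> card (layer (verts G) lev i) = blow_up_sizes j a b c i"
    and arcs: "arcs_ends G = layered_pairs (verts G) lev"
    and r: "1 \<le> r"
  shows "digraph_iso G (H_blow_up r j a b c)"
proof -
  let ?B = "H_blow_up r j a b c" and ?m = "blow_up_sizes j a b c"
  have "\<exists>g. bij_betw g (layer (verts G) lev i) {..<?m i}" if "i \<le> r" for i
    by (rule finite_same_card_bij) (auto simp: layer_def sizes[OF that, unfolded layer_def])
  then obtain g where g: "\<And>i. i \<le> r \<Longrightarrow> bij_betw (g i) (layer (verts G) lev i) {..<?m i}"
    by metis
  define f where "f x = (lev x, g (lev x) x)" for x
  have g_inj: "x = y" if "x \<in> verts G" "y \<in> verts G" "lev x = lev y" "g (lev x) x = g (lev x) y" for x y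
    using g[OF lev_r[OF that(1)]] that by (auto simp: bij_betw_def inj_on_def layer_def)
  have f_inj: "inj_on f (verts G)"
    by (rule inj_onI) (auto simp: f_def intro: g_inj)
  have f_onto: "\<exists>x\<in>verts G. lev x = i \<and> g i x = k" if "i \<le> r" "k < ?m i" for i k
  proof -
    have "k \<in> g i ` layer (verts G) lev i" using g[OF that(1)] that(2) by (simp add: bij_betw_def)
    then show ?thesis by (auto simp: layer_def)
  qed
  have g_less: "g (lev x) x < ?m (lev x)" if "x \<in> verts G" for x
    using bij_betwE[OF g[OF lev_r[OF that]]] that by (auto simp: layer_def)
  define h where "h e = ((lev (tail G e), lev (head G e)),
    (g (lev (tail G e)) (tail G e), g (lev (head G e)) (head G e)))" for e
  \<comment> \<open>Head and tail are taken from the target, so that \<open>app_iso hom G\<close>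
    equals \<open>?B\<close> as a record.\<close>
  define hom where "hom = \<lparr>iso_verts = f, iso_arcs = h, iso_head = head ?B, iso_tail = tail ?B\<rparr>"
  \<comment> \<open>Without parallel arcs an arc is determined by its ends, and these by their
    levels and their numbers within the layers.\<close>
  have h_inj: "inj_on h (arcs G)"
  proof (rule inj_onI)
    fix e e' assume e: "e \<in> arcs G" "e' \<in> arcs G" and eq: "h e = h e'"
    then have "tail G e = tail G e'" "head G e = head G e'"
      by (auto simp: h_def intro: g_inj)
    with e show "e = e'" by (intro no_multi_arcs) (auto simp: arc_to_ends_def)
  qed
  have "verts ?B = f ` verts G"
    using lev_r g_less f_onto by (force simp: verts_H_blow_up f_def)
  moreover have "arcs ?B = h ` arcs G"
  proof (intro equalityI subsetI)
    fix p assume "p \<in> arcs ?B"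
    then obtain i i' k k' where p: "p = ((i, i'), k, k')" "i \<le> r" "i' \<le> r" "i' \<noteq> 0" "i' \<le> i + 1"
      "even i \<noteq> even i'" "k < ?m i" "k' < ?m i'"
      unfolding arcs_H_blow_up[OF r] by blast
    obtain x where x: "x \<in> verts G" "lev x = i" "g i x = k" using f_onto[OF p(2,7)] by blast
    obtain y where y: "y \<in> verts G" "lev y = i'" "g i' y = k'" using f_onto[OF p(3,8)] by blast
    have "(x, y) \<in> arcs_ends G" using x y p by (simp add: arcs layered_pairs_def)
    then obtain e where "e \<in> arcs G" "tail G e = x" "head G e = y" by auto
    then show "p \<in> h ` arcs G" using x y p by (auto simp: h_def intro!: image_eqI[of _ _ e])
  next
    fix p assume "p \<in> h ` arcs G"
    then obtain e where e: "e \<in> arcs G" "p = h e" by blast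
    then have "(tail G e, head G e) \<in> layered_pairs (verts G) lev"
      unfolding arcs[symmetric] by (auto simp: arcs_ends_conv)
    then show "p \<in> arcs ?B"
      using e lev_r g_less by (simp add: arcs_H_blow_up[OF r] h_def layered_pairs_def)
  qed
  ultimately have "?B = app_iso hom G"
    by (simp add: app_iso_def hom_def)
  moreover have "digraph_isomorphism hom"
    using f_inj h_inj wf_digraph
    by (auto simp: digraph_isomorphism_def hom_def f_def h_def tail_H_blow_up head_H_blow_up)
  ultimately show ?thesis unfolding digraph_iso_def by blast
qed

section \<open>Comparing an arbitrary digraph with its distance layering\<close>

lemma (in digraph) layering_maximizes_arcs:
  assumes bip: "bipartite_digraph G" and rad: "out_radius = ereal (real r)" and r: "3 \<le> r"
  obtains lev where "\<And>x. x \<in> verts G \<Longrightarrow> lev x \<le> r"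
    "card (layer (verts G) lev 0) = 1"
    "\<And>i. i \<le> r \<Longrightarrow> 0 < card (layer (verts G) lev i)"
    "card (arcs G) \<le> card (layered_pairs (verts G) lev)"
    "card (arcs G) = card (layered_pairs (verts G) lev) \<Longrightarrow>
      arcs_ends G = layered_pairs (verts G) lev"
proof -
  let ?V = "verts G" and ?R = "arcs_ends G"
  have R: "?R \<subseteq> ?V \<times> ?V" by (auto simp: arcs_ends_conv)
  \<comment> \<open>Arcs can be counted as pairs of ends because there are no parallel ones.\<close>
  have card_R: "card (arcs G) = card ?R"
    unfolding arcs_ends_def by (rule card_image[OF inj_on_arc_to_ends, symmetric])
  obtain U where bipU: "\<And>x y. (x, y) \<in> ?R \<Longrightarrow> (x \<in> U) \<noteq> (y \<in> U)"
  proof -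
    from bip obtain U W where UW: "U \<union> W = ?V" "U \<inter> W = {}" "independent_set G U" "independent_set G W"
      unfolding bipartite_digraph_def by blast
    have "(x \<in> U) \<noteq> (y \<in> U)" if xy: "(x, y) \<in> ?R" for x y
    proof -
      from xy obtain e where e: "e \<in> arcs G" "tail G e = x" "head G e = y" by auto
      moreover have "x \<in> U \<union> W" "y \<in> U \<union> W" using R xy UW(1) by auto
      ultimately show ?thesis using UW(2,3,4) unfolding independent_set_def by blast
    qed
    then show thesis by (rule that)
  qed
  note far = out_radius_eqD(2)[OF rad]
  from out_radius_eqD(1)[OF rad] obtain v0
    where v0: "v0 \<in> ?V" "\<And>v. v \<in> ?V \<Longrightarrow> \<exists>i\<le>r. (v0, v) \<in> ?R ^^ i" by blast
  show thesis
  proof (rule distance_layering[OF R bipU v0 far[OF v0(1)]])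
    fix lev :: "'a \<Rightarrow> nat"
    assume lev0: "lev v0 = (0::nat)"
      and lev_r: "\<And>x. x \<in> ?V \<Longrightarrow> lev x \<le> r"
      and root: "\<And>x. x \<in> ?V \<Longrightarrow> lev x = 0 \<Longrightarrow> x = v0"
      and step: "\<And>x y. (x, y) \<in> ?R \<Longrightarrow> lev y \<le> lev x + 1"
      and parity: "\<And>x y. (x, y) \<in> ?R \<Longrightarrow> even (lev x) \<noteq> even (lev y)"
      and pred: "\<And>x i. x \<in> ?V \<Longrightarrow> lev x = Suc i \<Longrightarrow> \<exists>z\<in>?V. lev z = i \<and> (z, x) \<in> ?R"
      and all: "\<And>i. i \<le> r \<Longrightarrow> \<exists>x\<in>?V. lev x = i"
    have lev_0_iff: "lev x = 0 \<longleftrightarrow> x = v0" if "x \<in> ?V" for x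
      using root[OF that] lev0 by blast
    then have "layer ?V lev 0 = {v0}" using v0(1) by (auto simp: layer_def)
    then have one: "card (layer ?V lev 0) = 1" by simp
    have pos: "0 < card (layer ?V lev i)" if "i \<le> r" for i
      using all[OF that] by (auto simp: card_gt_0_iff layer_def)
    let ?A = "layered_pairs ?V lev"
    have finA: "finite ?A"
      by (rule finite_subset[of _ "?V \<times> ?V"]) (auto simp: layered_pairs_def)
    have "card ?R \<le> card ?A \<and> (card ?R = card ?A \<longrightarrow> ?R = ?A)"
    \<comment> \<open>If no arc enters the root, all arcs are layered pairs. Otherwise the
      inequality is shown to be strict, so equality can occur only in the first case.\<close>
    proof (cases "\<exists>z. (z, v0) \<in> ?R")
      case False
      have "?R \<subseteq> ?A"
      proof (rule subrelI)
        fix x y assume xy: "(x, y) \<in> ?R"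
        then have "x \<in> ?V" "y \<in> ?V" using R by auto
        moreover have "lev y \<noteq> 0" using xy False lev_0_iff[OF \<open>y \<in> ?V\<close>] by blast
        ultimately show "(x, y) \<in> ?A"
          using step[OF xy] parity[OF xy] by (simp add: layered_pairs_def)
      qed
      then show ?thesis using finA by (simp add: card_mono card_subset_eq)
    next
      case True
      then obtain z where z: "z \<in> ?V" "(z, v0) \<in> ?R" using R by blast
      let ?Odd = "{x \<in> ?V. odd (lev x)}"
      \<comment> \<open>\<open>layered_pairs\<close> without its ban on the root as a head. By
        parity this adds at most one pair for each odd vertex.\<close>
      define All where "All = {(x, y). x \<in> ?V \<and> y \<in> ?V \<and> lev y \<le> lev x + 1 \<and> even (lev x) \<noteq> even (lev y)}"
      have "\<exists>y\<in>?V. lev y \<le> lev x + 1 \<and> even (lev x) \<noteq> even (lev y) \<and> (x, y) \<notin> ?R"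
        if "x \<in> ?V - {v0}" for x
        using missing_pair[OF lev_r root lev0 parity pred far r z] that by blast
      then obtain s where s: "\<And>x. x \<in> ?V - {v0} \<Longrightarrow> (x, s x) \<in> All - ?R"
        unfolding All_def by (simp add: Bex_def) metis
      \<comment> \<open>One missing pair for each vertex other than the root; they are distinct
        because their first components are.\<close>
      let ?M = "(\<lambda>x. (x, s x)) ` (?V - {v0})"
      have finAll: "finite All"
        by (rule finite_subset[of _ "?V \<times> ?V"]) (auto simp: All_def)
      have "?R \<subseteq> All" using R step parity unfolding All_def by blast
      then have "card (?R \<union> ?M) \<le> card All" using s finAll by (intro card_mono) auto
      moreover have "card (?R \<union> ?M) = card ?R + card ?M"
        by (rule card_Un_disjoint) (use s in \<open>auto simp: arcs_ends_def\<close>)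
      moreover have "card ?M = card (?V - {v0})" by (rule card_image) (auto simp: inj_on_def)
      moreover have "All \<subseteq> ?A \<union> ?Odd \<times> {v0}"
        using lev_0_iff by (auto simp: All_def layered_pairs_def intro: odd_pos)
      then have "card All \<le> card ?A + card (?Odd \<times> {v0})"
        using finA by (intro order_trans[OF card_mono card_Un_le]) auto
      \<comment> \<open>A vertex on level 2 is neither odd nor the root, so the missing pairs
        outnumber the pairs into the root.\<close>
      moreover have "card ?Odd < card (?V - {v0})"
      proof (rule psubset_card_mono)
        obtain w where "w \<in> ?V" "lev w = 2" using all[of 2] r by auto
        then have "w \<in> ?V - {v0} - ?Odd" using lev0 by auto
        moreover have "?Odd \<subseteq> ?V - {v0}" using lev0 by auto
        ultimately show "?Odd \<subset> ?V - {v0}" by blast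
      qed simp
      ultimately have "card ?R < card ?A" by (simp add: card_cartesian_product)
      then show ?thesis by simp
    qed
    then have "card (arcs G) \<le> card ?A" "card (arcs G) = card ?A \<Longrightarrow> ?R = ?A"
      unfolding card_R by blast+
    then show thesis by (intro that[of lev] lev_r one pos)
  qed
qed

theorem theorem5p1:
  fixes D :: "('a, 'b) pre_digraph" and r n :: nat
  assumes "digraph D"
    and "bipartite_digraph D"
    and "wf_digraph.out_radius D = ereal (real r)"
    and "r \<ge> 3"
    and "n = card (verts D)"
  shows "int (card (arcs D)) \<le>
           \<lceil>real n * (real n - 2) / 4\<rceil> + int r - 4 + \<lfloor>(real n - real r + 3)\<^sup>2 / 4\<rfloor>
       \<and> (int (card (arcs D)) =
           \<lceil>real n * (real n - 2) / 4\<rceil> + int r - 4 + \<lfloor>(real n - real r + 3)\<^sup>2 / 4\<rfloor>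
         \<longleftrightarrow> (\<exists>j a b c :: nat.
               blow_up_position r j c
             \<and> a > 0 \<and> b > 0 \<and> c > 0
             \<and> int a + int b + int c = int n - int r + 2
             \<and> \<bar>int a + int c - (int b + 1)\<bar> \<le> 1
             \<and> (odd r \<longrightarrow> card (even_class (H_blow_up r j a b c)) \<ge> card (odd_class (H_blow_up r j a b c)))
             \<and> digraph_iso D (H_blow_up r j a b c)))"
proof -
  interpret digraph D by fact
  let ?V = "verts D"
  show ?thesis
  proof (rule layering_maximizes_arcs[OF assms(2-4)])
    fix lev :: "'a \<Rightarrow> nat"
    assume lev_r: "\<And>x. x \<in> ?V \<Longrightarrow> lev x \<le> r"
      and one: "card (layer ?V lev 0) = 1"
      and pos: "\<And>i. i \<le> r \<Longrightarrow> 0 < card (layer ?V lev i)"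
      and le: "card (arcs D) \<le> card (layered_pairs ?V lev)"
      and tight: "card (arcs D) = card (layered_pairs ?V lev) \<Longrightarrow> arcs_ends D = layered_pairs ?V lev"
    have "\<forall>x\<in>?V. lev x \<le> r" "\<forall>i\<le>r. 0 < card (layer ?V lev i)" using lev_r pos by blast+
    note opt = layered_pairs_optimum[OF assms(4) finite_verts assms(5) this(1) one this(2)]
    define N where "N = (n - 1)\<^sup>2 div 4 + ((n - r - 1)\<^sup>2 div 4 + 2 * (n - r - 1) + r)"
    note opt = opt[folded N_def]
    have bound: "\<lceil>real n * (real n - 2) / 4\<rceil> + int r - 4 + \<lfloor>(real n - real r + 3)\<^sup>2 / 4\<rfloor> = int N"
      using bound_as_integer[OF opt(1)] by (simp add: N_def)
    have r1: "1 \<le> r" using assms(4) by simp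
    show ?thesis
      unfolding bound of_nat_le_iff of_nat_eq_iff
    proof (intro conjI iffI)
      show "card (arcs D) \<le> N" using le opt(2) by linarith
    next
      assume eq: "card (arcs D) = N"
      \<comment> \<open>The layered pairs are squeezed between the arcs and \<open>N\<close>.
        Tightness above fixes the layer sizes; tightness below makes every layered pair an
        arc.\<close>
      then have eq': "card (layered_pairs ?V lev) = N" using le opt(2) by linarith
      then obtain j a b c where *: "blow_up_position r j c" "0 < a" "0 < b" "0 < c"
        "int a + int b + int c = int n - int r + 2" "\<bar>int a + int c - (int b + 1)\<bar> \<le> 1"
        and par: "odd r \<longrightarrow> card {x \<in> ?V. odd (lev x)} \<le> card {x \<in> ?V. even (lev x)}"
        and sizes: "\<And>i. i \<le> r \<Longrightarrow> card (layer ?V lev i) = blow_up_sizes j a b c i"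
        using opt(3) by blast
      let ?B = "H_blow_up r j a b c"
      \<comment> \<open>Equal layer sizes carry the comparison of the parity classes from
        \<open>D\<close> over to the blow-up.\<close>
      have classes: "card {x \<in> verts ?B. Q (fst x)} = card {x \<in> ?V. Q (lev x)}" for Q
      proof -
        have "card {x \<in> verts ?B. Q (fst x)} = (\<Sum>i | i \<le> r \<and> Q i. card (layer (verts ?B) fst i))"
          by (rule card_levels[OF finite_verts_H_blow_up]) (auto simp: verts_H_blow_up)
        also have "\<dots> = (\<Sum>i | i \<le> r \<and> Q i. card (layer ?V lev i))"
          by (rule sum.cong) (auto simp: card_layer_H_blow_up sizes)
        also have "\<dots> = card {x \<in> ?V. Q (lev x)}"
          by (rule card_levels[symmetric]) (use lev_r in auto)
        finally show ?thesis .
      qed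
      have "odd r \<longrightarrow> card (odd_class ?B) \<le> card (even_class ?B)"
        using par classes[of even] classes[of "\<lambda>i. odd i"]
        unfolding odd_class_def even_class_def by simp
      moreover have "digraph_iso D ?B"
        by (rule iso_H_blow_upI[OF lev_r sizes tight r1]) (use eq eq' in auto)
      ultimately show "\<exists>j a b c. blow_up_position r j c \<and> a > 0 \<and> b > 0 \<and> c > 0
          \<and> int a + int b + int c = int n - int r + 2 \<and> \<bar>int a + int c - (int b + 1)\<bar> \<le> 1
          \<and> (odd r \<longrightarrow> card (even_class (H_blow_up r j a b c)) \<ge> card (odd_class (H_blow_up r j a b c)))
          \<and> digraph_iso D (H_blow_up r j a b c)"
        using * by blast
    next
      assume "\<exists>j a b c. blow_up_position r j c \<and> a > 0 \<and> b > 0 \<and> c > 0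
          \<and> int a + int b + int c = int n - int r + 2 \<and> \<bar>int a + int c - (int b + 1)\<bar> \<le> 1
          \<and> (odd r \<longrightarrow> card (even_class (H_blow_up r j a b c)) \<ge> card (odd_class (H_blow_up r j a b c)))
          \<and> digraph_iso D (H_blow_up r j a b c)"
      then obtain j a b c where *: "blow_up_position r j c" "0 < a" "0 < b" "0 < c"
        "int a + int b + int c = int n - int r + 2" "\<bar>int a + int c - (int b + 1)\<bar> \<le> 1"
        and par: "odd r \<longrightarrow> card (odd_class (H_blow_up r j a b c)) \<le> card (even_class (H_blow_up r j a b c))"
        and iso: "digraph_iso D (H_blow_up r j a b c)" by blast
      let ?B = "H_blow_up r j a b c"
      from iso obtain hom where hom: "digraph_isomorphism hom" "?B = app_iso hom D"
        unfolding digraph_iso_def by blast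
      \<comment> \<open>The isomorphism transports the order and the number of arcs; the counting
        itself takes place in \<open>?B\<close>, layered by index.\<close>
      have cards: "card (verts ?B) = n" "card (arcs ?B) = card (arcs D)"
        using hom(1) unfolding hom(2) assms(5)
        by (auto simp: card_image digraph_isomorphism_def)
      have fst_r: "\<forall>x\<in>verts ?B. fst x \<le> r" by (auto simp: verts_H_blow_up)
      \<comment> \<open>Every admissible position has \<open>1 \<le> j\<close>, so index 0 keeps a
        single copy.\<close>
      have one_B: "card (layer (verts ?B) fst 0) = 1"
        using *(1) by (auto simp: card_layer_H_blow_up blow_up_sizes_def blow_up_position_def)
      have pos_B: "\<forall>i\<le>r. 0 < card (layer (verts ?B) fst i)"
        using *(2-4) by (simp add: card_layer_H_blow_up blow_up_sizes_def)
      have "card (layered_pairs (verts ?B) fst) = N"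
        unfolding N_def layered_pairs_optimum(3)[OF assms(4) finite_verts_H_blow_up cards(1)[symmetric]
            fst_r one_B pos_B]
        using * par unfolding even_class_def odd_class_def
        by (intro exI[of _ j] exI[of _ a] exI[of _ b] exI[of _ c]) (simp add: card_layer_H_blow_up)
      then show "card (arcs D) = N"
        using card_arcs_H_blow_up[OF r1] cards(2) by metis
    qed
  qed
qed

end
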